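(* Let $r$ be a fixed positive integer. For each $p$, let $B$ be a $p\times r$ real matrix with columns $b_1,\dots,b_r$, and let $\Sigma_f=\{\Sigma_{f,ij}(\cdot,\cdot)\}_{r\times r}$ and $\Sigma_\varepsilon=\{\Sigma_{\varepsilon,ij}(\cdot,\cdot)\}_{p\times p}$ be the covariance matrix functions of $f_t(\cdot)$ and $\varepsilon_t(\cdot)$, where $y_t(\cdot)=Bf_t(\cdot)+\varepsilon_t(\cdot)$ with $f_t$ and $\varepsilon_t$ uncorrelated, so that $\Sigma_y(u,v)=B\Sigma_f(u,v)B^{T}+\Sigma_\varepsilon(u,v)$ for $(u,v)\in\mathcal U^2$. Put $$\Omega=\iint\Sigma_y(u,v)\Sigma_y(u,v)^{T}\,du\,dv=\Omega_{L}+\Omega_{R},\qquad \Omega_{L}=B\Big\{\iint\Sigma_f(u,v)B^{T}B\Sigma_f(u,v)^{T}\,du\,dv\Big\}B^{T},$$ with $\Omega_R=\Omega-\Omega_L$. Suppose that $p^{-1}B^{T}B=I_r$; that $\iint\Sigma_f(u,v)\Sigma_f(u,v)^{T}\,du\,dv=\mathrm{diag}(\theta_1,\dots,\theta_r)$, where there exist constants $\overline\theta>\underline\theta>0$ such that $\overline\theta>\theta_1>\theta_2>\dots>\theta_r>\underline\theta$; and that $\|\Omega_R\|=o(p^2)$. Let $\lambda_1\ge\dots\ge\lambda_p$ be the ordered eigenvalues of $\Omega$ with corresponding (unit) eigenvectors $\xi_1,\dots,\xi_p$, and let $\widetilde b_j=p^{-1/2}b_j$. Then: (i) $|\lambda_j-p^2\theta_j|\le\|\Omega_R\|$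 for $j\in[r]$, and $|\lambda_j|\le\|\Omega_R\|$ for $j\in[p]\setminus[r]$; (ii) $\|\xi_j-\widetilde b_j\|=O(p^{-2}\|\Omega_R\|)$ for $j\in[r]$.
   Context: $\mathcal U$ is a compact interval and $[m]=\{1,\dots,m\}$. The covariance matrix function of a random vector of functions $z_t(\cdot)$ is $\Sigma_z(u,v)=\mathrm{Cov}\{z_t(u),z_t(v)\}$, $(u,v)\in\mathcal U^2$, with square-integrable entries. $\|\cdot\|$ denotes the operator (spectral) norm of a matrix and the Euclidean norm of a vector. Asymptotics are as $p\to\infty$.
   Formalization: Part (ii) is stated up to a sign s_p in {1,-1} multiplying ξ_j, since unit eigenvectors are determined only up to sign and the bound fails for -ξ_j; the θ_j are taken as constants not depending on p, and p ranges over p ≥ r. *)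

theory Defs
  imports
    "HOL-Probability.Probability"
    "HOL-Library.Landau_Symbols"
    "Jordan_Normal_Form.Char_Poly"
begin

text \<open>
  The dimension \<open>p\<close> of the observed functions tends to infinity, so vectors and matrices are those
  of \<^theory>\<open>Jordan_Normal_Form.Matrix\<close>, whose dimensions are natural numbers. Indices are counted
  from 0: the columns \<open>b\<^sub>1, \<dots>, b\<^sub>r\<close> are \<open>col B 0, \<dots>, col B (r - 1)\<close>, and likewise for
  eigenvalues and eigenvectors.
\<close>

definition vnorm :: "real vec \<Rightarrow> real" where
  "vnorm x = sqrt (x \<bullet> x)"

definition opnorm :: "real mat \<Rightarrow> real" where
  "opnorm A = (SUP x \<in> {x \<in> carrier_vec (dim_col A). vnorm x \<le> 1}. vnorm (A *\<^sub>v x))"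

text \<open>The \<open>n\<close> eigenvalues, listed with algebraic multiplicity in non-increasing order.\<close>

definition ordered_eigenvalues :: "real mat \<Rightarrow> (nat \<Rightarrow> real) \<Rightarrow> bool" where
  "ordered_eigenvalues A l \<longleftrightarrow>
     char_poly A = (\<Prod>j<dim_row A. [:- l j, 1:]) \<and>
     (\<forall>i j. i \<le> j \<longrightarrow> j < dim_row A \<longrightarrow> l j \<le> l i)"

text \<open>
  A random vector of functions is a map \<open>z\<close>, with \<open>z u \<omega>\<close> the value of the vector at the point \<open>u\<close>
  and outcome \<open>\<omega>\<close>. Second moments are required so that all the covariances below exist.
\<close>

definition random_vector_function ::
    "'a measure \<Rightarrow> real set \<Rightarrow> nat \<Rightarrow> (real \<Rightarrow> 'a \<Rightarrow> real vec) \<Rightarrow> bool" where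
  "random_vector_function M U n z \<longleftrightarrow>
     (\<forall>u\<in>U. (\<forall>\<omega>\<in>space M. z u \<omega> \<in> carrier_vec n) \<and>
       (\<forall>i<n. (\<lambda>\<omega>. vec_index (z u \<omega>) i) \<in> borel_measurable M \<and>
              integrable M (\<lambda>\<omega>. (vec_index (z u \<omega>) i)\<^sup>2)))"

definition covariance :: "'a measure \<Rightarrow> ('a \<Rightarrow> real) \<Rightarrow> ('a \<Rightarrow> real) \<Rightarrow> real" where
  "covariance M X Y =
     integral\<^sup>L M (\<lambda>\<omega>. (X \<omega> - integral\<^sup>L M X) * (Y \<omega> - integral\<^sup>L M Y))"

definition cross_cov_mat ::
    "'a measure \<Rightarrow> nat \<Rightarrow> nat \<Rightarrow> (real \<Rightarrow> 'a \<Rightarrow> real vec) \<Rightarrow> (real \<Rightarrow> 'a \<Rightarrow> real vec)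
      \<Rightarrow> real \<Rightarrow> real \<Rightarrow> real mat" where
  "cross_cov_mat M m n z w u v =
     mat m n (\<lambda>(i, j). covariance M (\<lambda>\<omega>. vec_index (z u \<omega>) i) (\<lambda>\<omega>. vec_index (w v \<omega>) j))"

definition cov_mat ::
    "'a measure \<Rightarrow> nat \<Rightarrow> (real \<Rightarrow> 'a \<Rightarrow> real vec) \<Rightarrow> real \<Rightarrow> real \<Rightarrow> real mat" where
  "cov_mat M n z = cross_cov_mat M n n z z"

definition uncorrelated ::
    "'a measure \<Rightarrow> real set \<Rightarrow> nat \<Rightarrow> nat \<Rightarrow> (real \<Rightarrow> 'a \<Rightarrow> real vec) \<Rightarrow> (real \<Rightarrow> 'a \<Rightarrow> real vec)
      \<Rightarrow> bool" where
  "uncorrelated M U m n z w \<longleftrightarrow> (\<forall>u\<in>U. \<forall>v\<in>U. cross_cov_mat M m n z w u v = 0\<^sub>m m n)"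

definition square_integrable_entries ::
    "real set \<Rightarrow> nat \<Rightarrow> (real \<Rightarrow> real \<Rightarrow> real mat) \<Rightarrow> bool" where
  "square_integrable_entries U n S \<longleftrightarrow>
     (\<forall>i<n. \<forall>j<n.
        (\<lambda>(u, v). S u v $$ (i, j)) \<in> borel_measurable (lebesgue_on (U \<times> U)) \<and>
        integrable (lebesgue_on (U \<times> U)) (\<lambda>(u, v). (S u v $$ (i, j))\<^sup>2))"

text \<open>The double integral over \<open>U \<times> U\<close> of an \<open>n \<times> n\<close> matrix function, taken entrywise.\<close>

definition double_integral_mat ::
    "real set \<Rightarrow> nat \<Rightarrow> (real \<Rightarrow> real \<Rightarrow> real mat) \<Rightarrow> real mat" where
  "double_integral_mat U n S =
     mat n n (\<lambda>(i, j). integral\<^sup>L (lebesgue_on (U \<times> U)) (\<lambda>(u, v). S u v $$ (i, j)))"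

end

theory Submission
  imports Defs
begin

text \<open>
  With \<open>Q = p\<^sup>-\<^sup>1\<^sup>/\<^sup>2 B\<close>, which has orthonormal columns, the signal part is
  \<open>\<Omega>\<^sub>L = Q diag(p\<^sup>2 \<theta>\<^sub>1, \<dots>, p\<^sup>2 \<theta>\<^sub>r) Q\<^sup>T\<close>. Part (i) is Weyl's inequality for
  \<open>\<Omega> = \<Omega>\<^sub>L + \<Omega>\<^sub>R\<close>: a span of \<open>j + 1\<close> eigenvectors of one matrix meets the orthogonal complement of
  \<open>j\<close> eigenvectors of the other, and the quadratic forms are compared there. Part (ii) is a
  Davis--Kahan bound: \<open>(\<Omega>\<^sub>L - p\<^sup>2 \<theta>\<^sub>j) \<xi>\<^sub>j = (\<lambda>\<^sub>j - p\<^sup>2 \<theta>\<^sub>j) \<xi>\<^sub>j - \<Omega>\<^sub>R \<xi>\<^sub>j\<close> has norm at most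
  \<open>2 \<parallel>\<Omega>\<^sub>R\<parallel>\<close>, while \<open>\<Omega>\<^sub>L - p\<^sup>2 \<theta>\<^sub>j\<close> stretches the component of \<open>\<xi>\<^sub>j\<close> orthogonal to the \<open>j\<close>-th
  column of \<open>Q\<close> by at least \<open>p\<^sup>2\<close> times the gap between \<open>\<theta>\<^sub>j\<close> and the other \<open>\<theta>\<^sub>k\<close> and 0.
\<close>

unbundle no inner_syntax
unbundle no vec_syntax

section \<open>Euclidean and operator norms\<close>

lemma vnorm_sq: "(vnorm x)\<^sup>2 = x \<bullet> x"
  by (simp add: vnorm_def scalar_prod_def sum_nonneg)

lemma vnorm_nonneg [simp]: "0 \<le> vnorm x"
  by (simp add: vnorm_def scalar_prod_def sum_nonneg)

lemma scalar_prod_self_nonneg [simp]: "0 \<le> (x :: real vec) \<bullet> x"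
  by (simp add: scalar_prod_def sum_nonneg)

lemma scalar_prod_self_eq_0_iff:
  assumes "(x :: real vec) \<in> carrier_vec n"
  shows "x \<bullet> x = 0 \<longleftrightarrow> x = 0\<^sub>v n"
proof
  assume "x \<bullet> x = 0"
  then have "\<forall>i\<in>{0..<n}. vec_index x i * vec_index x i = 0"
    using assms by (subst (asm) scalar_prod_def, subst (asm) sum_nonneg_eq_0_iff) auto
  then show "x = 0\<^sub>v n" using assms by auto
qed (use assms in auto)

lemma scalar_prod_self_pos:
  assumes "(x :: real vec) \<in> carrier_vec n" "x \<noteq> 0\<^sub>v n"
  shows "0 < x \<bullet> x"
  using scalar_prod_self_eq_0_iff[OF assms(1)] assms(2) scalar_prod_self_nonneg[of x] by linarith

lemma Cauchy_Schwarz_vec: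
  assumes "x \<in> carrier_vec n" "y \<in> carrier_vec n"
  shows "\<bar>x \<bullet> y\<bar> \<le> vnorm x * vnorm y"
proof (rule power2_le_imp_le)
  show "\<bar>x \<bullet> y\<bar>\<^sup>2 \<le> (vnorm x * vnorm y)\<^sup>2"
    using Cauchy_Schwarz_ineq_sum[of "vec_index x" "vec_index y" "{0..<n}"] assms
    unfolding power_mult_distrib vnorm_sq power2_abs by (simp add: scalar_prod_def power2_eq_square)
qed simp

lemma vnorm_smult: "vnorm (c \<cdot>\<^sub>v x) = \<bar>c\<bar> * vnorm x"
  by (simp add: vnorm_def real_sqrt_mult flip: mult.assoc)

lemma vnorm_diff_le:
  assumes "x \<in> carrier_vec n" "y \<in> carrier_vec n"
  shows "vnorm (x - y) \<le> vnorm x + vnorm y"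
proof (rule power2_le_imp_le)
  have "(vnorm (x - y))\<^sup>2 = x \<bullet> x - 2 * (x \<bullet> y) + y \<bullet> y"
    using assms comm_scalar_prod[OF assms]
    by (simp add: vnorm_sq minus_scalar_prod_distrib[of _ n] scalar_prod_minus_distrib[of _ n])
  also have "\<dots> \<le> (vnorm x + vnorm y)\<^sup>2"
    using Cauchy_Schwarz_vec[OF assms] by (simp add: power2_sum vnorm_sq)
  finally show "(vnorm (x - y))\<^sup>2 \<le> (vnorm x + vnorm y)\<^sup>2" .
qed simp

text \<open>Cauchy-Schwarz on each row bounds every value by the Frobenius norm, so the supremum in
  \<open>opnorm\<close> is a genuine least upper bound.\<close>

lemma opnorm_bdd_above:
  "bdd_above ((\<lambda>x. vnorm (A *\<^sub>v x)) ` {x \<in> carrier_vec (dim_col A). vnorm x \<le> 1})"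
proof (rule bdd_aboveI2)
  fix x assume x: "x \<in> {x \<in> carrier_vec (dim_col A). vnorm x \<le> 1}"
  have "(vnorm (A *\<^sub>v x))\<^sup>2 = (\<Sum>i<dim_row A. (row A i \<bullet> x)\<^sup>2)"
    unfolding vnorm_sq
    by (simp add: scalar_prod_def[of "A *\<^sub>v x"] power2_eq_square lessThan_atLeast0)
  also have "\<dots> \<le> (\<Sum>i<dim_row A. (vnorm (row A i))\<^sup>2)"
  proof (rule sum_mono)
    fix i
    have "\<bar>row A i \<bullet> x\<bar> \<le> vnorm (row A i) * vnorm x"
      using x by (intro Cauchy_Schwarz_vec[of _ "dim_col A"]) auto
    also have "\<dots> \<le> vnorm (row A i)"
      using x by (simp add: mult_left_le)
    finally show "(row A i \<bullet> x)\<^sup>2 \<le> (vnorm (row A i))\<^sup>2"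
      by (simp flip: abs_le_square_iff)
  qed
  finally show "vnorm (A *\<^sub>v x) \<le> sqrt (\<Sum>i<dim_row A. (vnorm (row A i))\<^sup>2)"
    by (rule real_le_rsqrt)
qed

text \<open>Homogeneity reduces the bound to the unit vector \<open>?y\<close>; the zero vector
  cannot be normalized and is treated apart.\<close>

lemma vnorm_mult_le_opnorm:
  assumes "x \<in> carrier_vec (dim_col A)"
  shows "vnorm (A *\<^sub>v x) \<le> opnorm A * vnorm x"
proof (cases "x \<bullet> x = 0")
  case True
  then have "x = 0\<^sub>v (dim_col A)" using scalar_prod_self_eq_0_iff[OF assms] by simp
  then have "A *\<^sub>v x = 0\<^sub>v (dim_row A)" by auto
  then show ?thesis using True by (simp add: vnorm_def)
next
  case False
  then have pos: "0 < vnorm x" by (simp add: vnorm_def less_le)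
  let ?y = "(1 / vnorm x) \<cdot>\<^sub>v x"
  have "vnorm ?y \<le> 1" using pos by (simp add: vnorm_smult)
  then have "vnorm (A *\<^sub>v ?y) \<le> opnorm A"
    unfolding opnorm_def using assms by (intro cSUP_upper[OF _ opnorm_bdd_above]) auto
  also have "A *\<^sub>v ?y = (1 / vnorm x) \<cdot>\<^sub>v (A *\<^sub>v x)"
    using assms by (intro mult_mat_vec) auto
  finally show ?thesis using pos by (simp add: vnorm_smult field_simps)
qed

lemma opnorm_nonneg [simp]: "0 \<le> opnorm A"
proof -
  have "vnorm (A *\<^sub>v 0\<^sub>v (dim_col A)) \<le> opnorm A"
    unfolding opnorm_def by (intro cSUP_upper[OF _ opnorm_bdd_above]) (auto simp: vnorm_def)
  then show ?thesis using vnorm_nonneg order_trans by blast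
qed

lemma abs_quadratic_form_le_opnorm:
  assumes "A \<in> carrier_mat n n" "x \<in> carrier_vec n"
  shows "\<bar>x \<bullet> (A *\<^sub>v x)\<bar> \<le> opnorm A * (x \<bullet> x)"
proof -
  have "\<bar>x \<bullet> (A *\<^sub>v x)\<bar> \<le> vnorm x * vnorm (A *\<^sub>v x)"
    using assms by (intro Cauchy_Schwarz_vec[of _ n]) auto
  also have "\<dots> \<le> vnorm x * (opnorm A * vnorm x)"
    using assms by (intro mult_left_mono vnorm_mult_le_opnorm) auto
  also have "\<dots> = opnorm A * (x \<bullet> x)"
    by (simp flip: vnorm_sq add: power2_eq_square)
  finally show ?thesis .
qed

section \<open>Matrices with orthonormal columns; kernels of small linear systems\<close>

lemma scalar_prod_isometry:
  fixes Q :: "real mat"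
  assumes "Q \<in> carrier_mat n m" "Q\<^sup>T * Q = 1\<^sub>m m" "x \<in> carrier_vec m" "y \<in> carrier_vec m"
  shows "(Q *\<^sub>v x) \<bullet> (Q *\<^sub>v y) = x \<bullet> y"
proof -
  have "(Q *\<^sub>v x) \<bullet> (Q *\<^sub>v y) = (Q\<^sup>T *\<^sub>v (Q *\<^sub>v x)) \<bullet> y"
    using transpose_vec_mult_scalar[OF assms(1,4), of "Q *\<^sub>v x"] assms by simp
  also have "Q\<^sup>T *\<^sub>v (Q *\<^sub>v x) = (Q\<^sup>T * Q) *\<^sub>v x"
    using assms by (intro assoc_mult_mat_vec[symmetric]) auto
  finally show ?thesis using assms by simp
qed

text \<open>\<open>Q *\<^sub>v ?a\<close> is the orthogonal projection of \<open>x\<close> onto the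
  column space; the squared length of the residual is the difference of the two sides.\<close>

lemma Bessel_inequality:
  fixes Q :: "real mat"
  assumes "Q \<in> carrier_mat n m" "Q\<^sup>T * Q = 1\<^sub>m m" "x \<in> carrier_vec n"
  shows "(Q\<^sup>T *\<^sub>v x) \<bullet> (Q\<^sup>T *\<^sub>v x) \<le> x \<bullet> x"
proof -
  let ?a = "Q\<^sup>T *\<^sub>v x"
  have a: "?a \<in> carrier_vec m" and Qa: "Q *\<^sub>v ?a \<in> carrier_vec n"
    using assms by (auto intro!: mult_mat_vec_carrier)
  have "x \<bullet> (Q *\<^sub>v ?a) = ?a \<bullet> ?a"
    using transpose_vec_mult_scalar[OF assms(1) a assms(3)] by simp
  moreover have "(Q *\<^sub>v ?a) \<bullet> (Q *\<^sub>v ?a) = ?a \<bullet> ?a"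
    using assms a by (intro scalar_prod_isometry) auto
  moreover have "(x - Q *\<^sub>v ?a) \<bullet> (x - Q *\<^sub>v ?a)
      = x \<bullet> x - x \<bullet> (Q *\<^sub>v ?a) - (x \<bullet> (Q *\<^sub>v ?a) - (Q *\<^sub>v ?a) \<bullet> (Q *\<^sub>v ?a))"
    using assms Qa comm_scalar_prod[OF assms(3) Qa]
    by (simp add: minus_scalar_prod_distrib[of _ n] scalar_prod_minus_distrib[of _ n])
  ultimately show ?thesis
    using scalar_prod_self_nonneg[of "x - Q *\<^sub>v ?a"] by linarith
qed

text \<open>At most \<open>j\<close> equations in \<open>j + 1\<close> unknowns: row \<open>j\<close> of the square matrix below is left zero.\<close>

lemma exists_kernel_vec:
  fixes K :: "real mat"
  assumes "K \<in> carrier_mat k m" "j < m"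
  obtains c where "c \<in> carrier_vec m" "c \<noteq> 0\<^sub>v m"
    "\<And>i. j < i \<Longrightarrow> i < m \<Longrightarrow> vec_index c i = 0"
    "\<And>i. i < j \<Longrightarrow> i < k \<Longrightarrow> vec_index (K *\<^sub>v c) i = 0"
proof -
  let ?N = "mat m m (\<lambda>(i, l). if j < i then if l = i then 1 else 0
              else if i < j \<and> i < k then K $$ (i, l) else 0 :: real)"
  \<comment> \<open>A zero row makes \<open>?N\<close> singular. On a kernel vector the unit rows
    after \<open>j\<close> annihilate the tail, and the rows before \<open>j\<close> impose the
    equations from \<open>K\<close>.\<close>
  have "row ?N j = 0\<^sub>v m" using assms by (intro eq_vecI) auto
  then have "?N\<^sup>T *\<^sub>v unit_vec m j = 0\<^sub>v m"
    using assms by (intro eq_vecI) (auto simp: row_def)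
  then have "det ?N\<^sup>T = 0"
    using assms by (subst det_0_iff_vec_prod_zero_field[of _ m]) (auto intro!: exI[of _ "unit_vec m j"])
  then have "det ?N = 0" by (subst (asm) det_transpose[of _ m]) auto
  then obtain c where c: "c \<in> carrier_vec m" "c \<noteq> 0\<^sub>v m" "?N *\<^sub>v c = 0\<^sub>v m"
    using det_0_iff_vec_prod_zero_field[of ?N m] by auto
  have N: "row ?N i \<bullet> c = 0" if "i < m" for i
    using arg_cong[OF c(3), of "\<lambda>v. vec_index v i"] that by simp
  have "vec_index c i = 0" if "j < i" "i < m" for i
  proof -
    have "row ?N i = unit_vec m i" using that by (intro eq_vecI) auto
    then show ?thesis using N[OF that(2)] c(1) that by simp
  qed
  moreover have "vec_index (K *\<^sub>v c) i = 0" if "i < j" "i < k" for i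
  proof -
    have "row ?N i = row K i" using that assms by (intro eq_vecI) auto
    then show ?thesis using N[of i] that assms by simp
  qed
  ultimately show thesis using c that by blast
qed

section \<open>Diagonalization of symmetric matrices\<close>

text \<open>For \<open>w = 0\<close> the division by zero makes this the identity matrix.\<close>

definition householder :: "real vec \<Rightarrow> real mat" where
  "householder w = mat (dim_vec w) (dim_vec w)
     (\<lambda>(i, j). (if i = j then 1 else 0) - 2 / (w \<bullet> w) * vec_index w i * vec_index w j)"

lemma householder_carrier [simp]: "w \<in> carrier_vec n \<Longrightarrow> householder w \<in> carrier_mat n n"
  by (auto simp: householder_def)

lemma householder_transpose [simp]: "(householder w)\<^sup>T = householder w"
  by (rule eq_matI) (auto simp: householder_def)

lemma householder_mult_vec:
  assumes "w \<in> carrier_vec n" "x \<in> carrier_vec n"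
  shows "householder w *\<^sub>v x = x - (2 / (w \<bullet> w) * (w \<bullet> x)) \<cdot>\<^sub>v w"
proof (rule eq_vecI)
  fix i assume "i < dim_vec (x - (2 / (w \<bullet> w) * (w \<bullet> x)) \<cdot>\<^sub>v w)"
  then have i: "i < n" using assms by simp
  have "vec_index (householder w *\<^sub>v x) i =
      (\<Sum>j = 0..<n. (if i = j then vec_index x j else 0)
         - 2 / (w \<bullet> w) * vec_index w i * (vec_index w j * vec_index x j))"
    using i assms
    by (auto simp: householder_def scalar_prod_def[of _ x] algebra_simps intro!: sum.cong)
  also have "\<dots> = vec_index x i - 2 / (w \<bullet> w) * vec_index w i * (w \<bullet> x)"
    using i assms
    by (simp add: sum_subtractf scalar_prod_def[of _ x] sum_distrib_left sum_divide_distrib mult.assoc)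
  finally show "vec_index (householder w *\<^sub>v x) i
      = vec_index (x - (2 / (w \<bullet> w) * (w \<bullet> x)) \<cdot>\<^sub>v w) i"
    using i assms by simp
qed (use assms in \<open>simp add: householder_def\<close>)

lemma mult_mat_unit_vec:
  assumes "A \<in> carrier_mat m n" "j < n"
  shows "(A :: real mat) *\<^sub>v unit_vec n j = col A j"
  using assms by (intro eq_vecI) auto

lemma householder_involution:
  assumes "w \<in> carrier_vec n"
  shows "householder w * householder w = 1\<^sub>m n"
proof (rule mat_col_eqI)
  fix j assume "j < dim_col (1\<^sub>m n)"
  then have j: "j < n" by simp
  let ?H = "householder w"
  have H: "?H \<in> carrier_mat n n" using assms by simp
  define x :: "real vec" where "x = unit_vec n j"
  have x: "x \<in> carrier_vec n" by (simp add: x_def)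
  let ?k = "2 / (w \<bullet> w) * (w \<bullet> x)"
  have y: "x - ?k \<cdot>\<^sub>v w \<in> carrier_vec n" using x assms by simp
  \<comment> \<open>The first reflection flips the component along \<open>w\<close>, so the second
    one subtracts with coefficient \<open>- ?k\<close> and undoes it. For \<open>w = 0\<close> both
    sides are 0 by division by zero.\<close>
  have "2 / (w \<bullet> w) * (w \<bullet> (x - ?k \<cdot>\<^sub>v w)) = - ?k"
    using x assms by (simp add: scalar_prod_minus_distrib[of _ n] field_simps)
  then have "?H *\<^sub>v (?H *\<^sub>v x) = x - ?k \<cdot>\<^sub>v w - (- ?k) \<cdot>\<^sub>v w"
    using x y assms by (simp add: householder_mult_vec[of _ n])
  also have "\<dots> = x" using x assms by (intro eq_vecI) auto
  finally have "(?H * ?H) *\<^sub>v x = x" using H x by (simp add: assoc_mult_mat_vec[of _ n n _ n])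
  then show "col (?H * ?H) j = col (1\<^sub>m n) j"
    using H j by (simp add: x_def mult_mat_unit_vec[of _ n n])
qed (use assms in \<open>simp_all add: householder_def\<close>)

text \<open>Two vectors of equal length are swapped by the reflection along their difference. If
  \<open>v\<close> is the unit vector itself, the difference is 0 and the reflection degenerates to
  the identity.\<close>

lemma householder_unit_vec:
  assumes v: "v \<in> carrier_vec n" "v \<bullet> v = 1" and n: "0 < n"
  shows "householder (v - unit_vec n 0) *\<^sub>v unit_vec n 0 = v"
proof -
  let ?e = "unit_vec n 0 :: real vec" and ?w = "v - unit_vec n 0"
  have e: "?e \<in> carrier_vec n" and w: "?w \<in> carrier_vec n" using v by auto
  have ww: "?w \<bullet> ?w = 2 - 2 * vec_index v 0" and we: "?w \<bullet> ?e = vec_index v 0 - 1"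
    using v e n by (simp_all add: minus_scalar_prod_distrib[of _ n] scalar_prod_minus_distrib[of _ n])
  show ?thesis
  proof (cases "?w \<bullet> ?w = 0")
    case True
    then have w0: "?w = 0\<^sub>v n" using scalar_prod_self_eq_0_iff[OF w] by simp
    have "vec_index v i = vec_index ?e i" if "i < n" for i
      using arg_cong[OF w0, of "\<lambda>x. vec_index x i"] that v by simp
    then have "v = ?e" using v by (intro eq_vecI) auto
    moreover have "householder ?w *\<^sub>v ?e = ?e"
      using e w by (subst householder_mult_vec[OF w e]) (auto simp: True)
    ultimately show ?thesis by simp
  next
    case False
    then have "2 / (?w \<bullet> ?w) * (?w \<bullet> ?e) = - 1"
      unfolding ww we by (simp add: field_simps)
    then show ?thesis
      using v by (subst householder_mult_vec[OF w e]) (intro eq_vecI, auto)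
  qed
qed

lemma four_block_diag_mult:
  fixes a b :: real
  assumes "A \<in> carrier_mat n n" "B \<in> carrier_mat n n"
  shows "four_block_mat (mat 1 1 (\<lambda>_. a)) (0\<^sub>m 1 n) (0\<^sub>m n 1) A *
         four_block_mat (mat 1 1 (\<lambda>_. b)) (0\<^sub>m 1 n) (0\<^sub>m n 1) B =
         four_block_mat (mat 1 1 (\<lambda>_. a * b)) (0\<^sub>m 1 n) (0\<^sub>m n 1) (A * B)"
proof -
  have "mat 1 1 (\<lambda>_. a) * mat 1 1 (\<lambda>_. b) = mat 1 1 (\<lambda>_. a * b)"
    by (rule eq_matI) (auto simp: scalar_prod_def)
  then show ?thesis
    using assms by (subst mult_four_block_mat[of _ 1 1 _ n _ n _ _ 1 _ n]) auto
qed

text \<open>Induction by deflation: a Householder reflection carries a unit eigenvector for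
  \<open>l 0\<close> to the first basis vector, and symmetry then splits off a smaller symmetric
  block. The factored characteristic polynomial supplies the real eigenvalue and fixes the order on
  the diagonal.\<close>

theorem symmetric_diagonalization:
  fixes A :: "real mat"
  assumes "A \<in> carrier_mat n n" "A\<^sup>T = A" "char_poly A = (\<Prod>j<n. [:- l j, 1:])"
  obtains U where "U \<in> carrier_mat n n" "U\<^sup>T * U = 1\<^sub>m n" "U\<^sup>T * A * U = mat_diag n l"
proof -
  have "\<exists>U \<in> carrier_mat n n. U\<^sup>T * U = 1\<^sub>m n \<and> U\<^sup>T * A * U = mat_diag n l"
    using assms
  proof (induction n arbitrary: A l)
    case 0
    then show ?case by (intro bexI[of _ "1\<^sub>m 0"]) (auto simp: mat_diag_def intro!: eq_matI)
  next
    case (Suc n)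
    note A = Suc.prems(1)
    let ?N = "Suc n"
    let ?e = "unit_vec ?N 0 :: real vec"
    have "poly (char_poly A) (l 0) = 0"
      unfolding Suc.prems(3) poly_prod by (intro prod_zero) auto
    then obtain v0 where "eigenvector A v0 (l 0)"
      using eigenvalue_root_char_poly[OF A] unfolding eigenvalue_def by blast
    then have v0: "v0 \<in> carrier_vec ?N" "v0 \<noteq> 0\<^sub>v ?N" "A *\<^sub>v v0 = l 0 \<cdot>\<^sub>v v0"
      using A by (auto simp: eigenvector_def)
    define v where "v = (1 / vnorm v0) \<cdot>\<^sub>v v0"
    have pos: "0 < v0 \<bullet> v0" using v0 by (intro scalar_prod_self_pos)
    have v: "v \<in> carrier_vec ?N" using v0 by (simp add: v_def)
    have "v \<bullet> v = 1"
      unfolding v_def using pos v0 by (simp add: vnorm_def)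
    note vv = this
    have Av: "A *\<^sub>v v = l 0 \<cdot>\<^sub>v v"
      unfolding v_def using v0 mult_mat_vec[OF A v0(1)] by (auto simp: smult_smult_assoc mult.commute)
    define H where "H = householder (v - ?e)"
    have H: "H \<in> carrier_mat ?N ?N" and HT: "H\<^sup>T = H" and HH: "H * H = 1\<^sub>m ?N" and He: "H *\<^sub>v ?e = v"
      unfolding H_def using v vv
      by (auto intro!: householder_involution householder_unit_vec)
    have Hv: "H *\<^sub>v v = ?e"
    proof -
      have "H *\<^sub>v v = (H * H) *\<^sub>v ?e"
        unfolding He[symmetric] using H by (simp add: assoc_mult_mat_vec[of _ ?N ?N _ ?N])
      then show ?thesis by (simp add: HH)
    qed
    define A' where "A' = H * A * H"
    have A': "A' \<in> carrier_mat ?N ?N" using H A by (simp add: A'_def)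
    have A'T: "A'\<^sup>T = A'"
      unfolding A'_def using H A Suc.prems(2) HT
      by (simp add: transpose_mult[of _ ?N ?N _ ?N] assoc_mult_mat[of _ ?N ?N _ ?N _ ?N])
    have "col A' 0 = A' *\<^sub>v ?e" using A' by (simp add: mult_mat_unit_vec)
    also have "\<dots> = H *\<^sub>v (A *\<^sub>v v)"
      unfolding A'_def using H A v by (simp add: assoc_mult_mat_vec[of _ ?N ?N _ ?N] He)
    also have "\<dots> = l 0 \<cdot>\<^sub>v ?e"
      using Av Hv mult_mat_vec[OF H v] by simp
    finally have col0: "col A' 0 = l 0 \<cdot>\<^sub>v ?e" .
    have e1: "A' $$ (i, 0) = (if i = 0 then l 0 else 0)" if "i < ?N" for i
      using arg_cong[OF col0, of "\<lambda>x. vec_index x i"] that A' by (auto split: if_splits)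
    have e2: "A' $$ (i, j) = A' $$ (j, i)" if "i < ?N" "j < ?N" for i j
      using arg_cong[OF A'T, of "\<lambda>x. x $$ (i, j)"] that A' by simp
    define D where "D = mat n n (\<lambda>(i, j). A' $$ (Suc i, Suc j))"
    have D: "D \<in> carrier_mat n n" by (simp add: D_def)
    have DT: "D\<^sup>T = D" by (rule eq_matI) (auto simp: D_def intro: e2)
    let ?block = "\<lambda>x X. four_block_mat (mat 1 1 (\<lambda>_. x)) (0\<^sub>m 1 n) (0\<^sub>m n 1) X :: real mat"
    \<comment> \<open>\<open>e1\<close> clears column 0 below the corner, and the symmetry
      \<open>e2\<close> clears row 0.\<close>
    have A'_block: "A' = ?block (l 0) D"
      by (rule eq_matI) (use A' in \<open>auto simp: e1 e2[of 0] D_def less_Suc_eq_0_disj\<close>)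
    have "similar_mat A A'"
    proof (rule similar_matI)
      have "H * A' * H = (H * H) * A * (H * H)"
        unfolding A'_def using H A by (simp add: assoc_mult_mat[of _ ?N ?N _ ?N _ ?N])
      then show "A = H * A' * H" using HH A by simp
    qed (use H A A' HH in auto)
    \<comment> \<open>Similar matrices share the characteristic polynomial, and that of the block
      matrix is a product. Cancelling the factor of \<open>l 0\<close> leaves the induction
      hypothesis for \<open>D\<close> with the list shifted by one.\<close>
    then have "(\<Prod>j<Suc n. [:- l j, 1:]) = char_poly (?block (l 0) D)"
      using char_poly_similar Suc.prems(3) A'_block by metis
    also have "\<dots> = char_poly (mat 1 1 (\<lambda>_. l 0)) * char_poly D"
      using D by (intro char_poly_four_block_zeros_col) auto
    also have "char_poly (mat 1 1 (\<lambda>_. l 0)) = [:- l 0, 1:]"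
      by (subst char_poly_upper_triangular[of _ 1]) (auto simp: diag_mat_def)
    finally have "[:- l 0, 1:] * (\<Prod>j<n. [:- l (Suc j), 1:]) = [:- l 0, 1:] * char_poly D"
      by (simp only: prod.lessThan_Suc_shift)
    then have "char_poly D = (\<Prod>j<n. [:- l (Suc j), 1:])"
      by (subst (asm) mult_cancel_left) auto
    from Suc.IH[OF D DT this] obtain V where
      V: "V \<in> carrier_mat n n" "V\<^sup>T * V = 1\<^sub>m n" "V\<^sup>T * D * V = mat_diag n (\<lambda>j. l (Suc j))"
      by blast
    \<comment> \<open>Bordering \<open>V\<close> with 1 fixes the first basis vector, so the corner
      \<open>l 0\<close> survives while \<open>V\<close> diagonalizes \<open>D\<close>.\<close>
    define F where "F = ?block 1 V"
    have F: "F \<in> carrier_mat ?N ?N" using V by (auto simp: F_def)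
    have "(mat 1 1 (\<lambda>_. 1 :: real))\<^sup>T = mat 1 1 (\<lambda>_. 1)" by (rule eq_matI) auto
    then have FT: "F\<^sup>T = ?block 1 V\<^sup>T"
      unfolding F_def using V by (subst transpose_four_block_mat[of _ 1 1 _ n _ n]) auto
    have FF: "F\<^sup>T * F = 1\<^sub>m ?N"
    proof -
      have "F\<^sup>T * F = ?block 1 (1\<^sub>m n)"
        unfolding FT unfolding F_def using V by (simp add: four_block_diag_mult del: One_nat_def)
      also have "\<dots> = 1\<^sub>m ?N" by (rule eq_matI) auto
      finally show ?thesis .
    qed
    have FA'F: "F\<^sup>T * A' * F = mat_diag ?N l"
    proof -
      have "F\<^sup>T * A' * F = ?block (l 0) (mat_diag n (\<lambda>j. l (Suc j)))"
        unfolding FT A'_block unfolding F_def using V D by (simp add: four_block_diag_mult del: One_nat_def)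
      also have "\<dots> = mat_diag ?N l" by (rule eq_matI) (auto simp: mat_diag_def)
      finally show ?thesis .
    qed
    let ?U = "H * F"
    have UT: "?U\<^sup>T = F\<^sup>T * H" using H F HT by (simp add: transpose_mult)
    have "?U\<^sup>T * ?U = F\<^sup>T * (H * H) * F"
      unfolding UT using H F by (simp add: assoc_mult_mat[of _ ?N ?N _ ?N _ ?N])
    then have "?U\<^sup>T * ?U = 1\<^sub>m ?N" using HH FF F by simp
    moreover have "?U\<^sup>T * A * ?U = F\<^sup>T * A' * F"
      unfolding UT A'_def using H F A by (simp add: assoc_mult_mat[of _ ?N ?N _ ?N _ ?N])
    ultimately show ?case using FA'F H F by (intro bexI[of _ ?U]) auto
  qed
  then show thesis using that by blast
qed

section \<open>Perturbation of eigenvalues and eigenvectors\<close>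

lemma mat_diag_mult_vec_index:
  assumes "x \<in> carrier_vec m" "i < m"
  shows "vec_index (mat_diag m \<mu> *\<^sub>v x) i = (\<mu> i * vec_index x i :: real)"
proof -
  have "row (mat_diag m \<mu>) i = \<mu> i \<cdot>\<^sub>v unit_vec m i"
    using assms by (intro eq_vecI) (auto simp: mat_diag_def)
  then show ?thesis using assms by (simp add: mat_diag_def)
qed

lemma mat_diag_mult_vec_carrier [simp]: "mat_diag m \<mu> *\<^sub>v x \<in> carrier_vec m"
  by (rule carrier_vecI) (simp add: mat_diag_def)

lemma scalar_prod_self_sum:
  assumes "(x :: real vec) \<in> carrier_vec n"
  shows "x \<bullet> x = (\<Sum>i<n. (vec_index x i)\<^sup>2)"
  using assms by (simp add: scalar_prod_def power2_eq_square lessThan_atLeast0)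

lemma factored_mult_vec:
  fixes Q :: "real mat"
  assumes "Q \<in> carrier_mat n m" "x \<in> carrier_vec n"
  shows "(Q * mat_diag m \<mu> * Q\<^sup>T) *\<^sub>v x = Q *\<^sub>v (mat_diag m \<mu> *\<^sub>v (Q\<^sup>T *\<^sub>v x))"
proof -
  have Qx: "Q\<^sup>T *\<^sub>v x \<in> carrier_vec m" using assms by (auto intro!: mult_mat_vec_carrier)
  have "(Q * mat_diag m \<mu> * Q\<^sup>T) *\<^sub>v x = (Q * mat_diag m \<mu>) *\<^sub>v (Q\<^sup>T *\<^sub>v x)"
    using assms by (intro assoc_mult_mat_vec[of _ n m _ n]) auto
  also have "\<dots> = Q *\<^sub>v (mat_diag m \<mu> *\<^sub>v (Q\<^sup>T *\<^sub>v x))"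
    using assms Qx by (intro assoc_mult_mat_vec[of _ n m _ m]) auto
  finally show ?thesis .
qed

lemma factored_quadratic_form:
  fixes Q :: "real mat"
  assumes "Q \<in> carrier_mat n m" "x \<in> carrier_vec n"
  shows "x \<bullet> ((Q * mat_diag m \<mu> * Q\<^sup>T) *\<^sub>v x) = (\<Sum>i<m. \<mu> i * (vec_index (Q\<^sup>T *\<^sub>v x) i)\<^sup>2)"
proof -
  let ?a = "Q\<^sup>T *\<^sub>v x"
  have a: "?a \<in> carrier_vec m" using assms by (auto intro!: mult_mat_vec_carrier)
  have "x \<bullet> ((Q * mat_diag m \<mu> * Q\<^sup>T) *\<^sub>v x) = ?a \<bullet> (mat_diag m \<mu> *\<^sub>v ?a)"
    using transpose_vec_mult_scalar[OF assms(1) _ assms(2)]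
    by (simp add: factored_mult_vec[OF assms])
  also have "\<dots> = (\<Sum>i<m. vec_index ?a i * vec_index (mat_diag m \<mu> *\<^sub>v ?a) i)"
    by (simp add: scalar_prod_def mat_diag_def lessThan_atLeast0)
  also have "\<dots> = (\<Sum>i<m. \<mu> i * (vec_index ?a i)\<^sup>2)"
    by (intro sum.cong refl) (simp add: mat_diag_mult_vec_index[OF a] power2_eq_square)
  finally show ?thesis .
qed

text \<open>
  The level \<open>t\<close> may be any nonnegative number by Bessel's inequality, and any real number if \<open>Q\<close> is
  a square orthogonal matrix.
\<close>

lemma Weyl_one_sided:
  fixes P Q :: "real mat"
  assumes P: "P \<in> carrier_mat n k" "P\<^sup>T * P = 1\<^sub>m k" and Q: "Q \<in> carrier_mat n m"
    and j: "j < k" and \<alpha>: "\<And>i. i \<le> j \<Longrightarrow> \<alpha> j \<le> \<alpha> i" and \<beta>: "\<And>i. j \<le> i \<Longrightarrow> i < m \<Longrightarrow> \<beta> i \<le> t"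
    and Bessel: "\<And>x. x \<in> carrier_vec n \<Longrightarrow> t * ((Q\<^sup>T *\<^sub>v x) \<bullet> (Q\<^sup>T *\<^sub>v x)) \<le> t * (x \<bullet> x)"
    and le: "\<And>x. x \<in> carrier_vec n \<Longrightarrow> (\<Sum>i<k. \<alpha> i * (vec_index (P\<^sup>T *\<^sub>v x) i)\<^sup>2)
               \<le> (\<Sum>i<m. \<beta> i * (vec_index (Q\<^sup>T *\<^sub>v x) i)\<^sup>2) + e * (x \<bullet> x)"
  shows "\<alpha> j \<le> t + e"
proof -
  have "Q\<^sup>T * P \<in> carrier_mat m k" using P Q by auto
  \<comment> \<open>\<open>c\<close> yields a nonzero combination \<open>x\<close> of columns 0 to
    \<open>j\<close> of \<open>P\<close> that is orthogonal to the columns of \<open>Q\<close> with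
    index below \<open>j\<close>: at most \<open>j\<close> equations in \<open>j + 1\<close>
    unknowns.\<close>
  from exists_kernel_vec[OF this j] obtain c where c: "c \<in> carrier_vec k" "c \<noteq> 0\<^sub>v k"
    and c_gt: "\<And>i. j < i \<Longrightarrow> i < k \<Longrightarrow> vec_index c i = 0"
    and K: "\<And>i. i < j \<Longrightarrow> i < m \<Longrightarrow> vec_index ((Q\<^sup>T * P) *\<^sub>v c) i = 0"
    by blast
  define x where "x = P *\<^sub>v c"
  have x: "x \<in> carrier_vec n" using P c by (auto simp: x_def)
  have xx: "x \<bullet> x = c \<bullet> c" unfolding x_def by (rule scalar_prod_isometry) (use P c in auto)
  have pos: "0 < x \<bullet> x" unfolding xx by (rule scalar_prod_self_pos[OF c])
  have Px: "P\<^sup>T *\<^sub>v x = c"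
    unfolding x_def using P c assoc_mult_mat_vec[of "P\<^sup>T" k n P k c] by simp
  have Qx: "Q\<^sup>T *\<^sub>v x \<in> carrier_vec m" using Q x by (auto intro!: mult_mat_vec_carrier)
  have Qx_0: "vec_index (Q\<^sup>T *\<^sub>v x) i = 0" if "i < j" "i < m" for i
    unfolding x_def using K[OF that] P Q c assoc_mult_mat_vec[of "Q\<^sup>T" m n P k c] by simp
  \<comment> \<open>On this \<open>x\<close> only indices up to \<open>j\<close> contribute to the
    \<alpha> sum, and only indices from \<open>j\<close> on to the \<beta> sum, so the weights can
    be replaced by \<open>\<alpha> j\<close> and \<open>t\<close>.\<close>
  have "\<alpha> j * (x \<bullet> x) = (\<Sum>i<k. \<alpha> j * (vec_index c i)\<^sup>2)"
    by (simp add: xx scalar_prod_self_sum[OF c(1)] sum_distrib_left)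
  also have "\<dots> \<le> (\<Sum>i<k. \<alpha> i * (vec_index c i)\<^sup>2)"
  proof (rule sum_mono)
    fix i assume "i \<in> {..<k}"
    then show "\<alpha> j * (vec_index c i)\<^sup>2 \<le> \<alpha> i * (vec_index c i)\<^sup>2"
      using \<alpha>[of i] c_gt[of i] by (cases "i \<le> j") (auto intro: mult_right_mono)
  qed
  also have "\<dots> \<le> (\<Sum>i<m. \<beta> i * (vec_index (Q\<^sup>T *\<^sub>v x) i)\<^sup>2) + e * (x \<bullet> x)"
    using le[OF x] by (simp add: Px)
  also have "(\<Sum>i<m. \<beta> i * (vec_index (Q\<^sup>T *\<^sub>v x) i)\<^sup>2) \<le> (\<Sum>i<m. t * (vec_index (Q\<^sup>T *\<^sub>v x) i)\<^sup>2)"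
  proof (rule sum_mono)
    fix i assume "i \<in> {..<m}"
    then show "\<beta> i * (vec_index (Q\<^sup>T *\<^sub>v x) i)\<^sup>2 \<le> t * (vec_index (Q\<^sup>T *\<^sub>v x) i)\<^sup>2"
      using \<beta>[of i] Qx_0[of i] by (cases "i < j") (auto intro: mult_right_mono)
  qed
  also have "\<dots> = t * ((Q\<^sup>T *\<^sub>v x) \<bullet> (Q\<^sup>T *\<^sub>v x))"
    by (simp add: scalar_prod_self_sum[OF Qx] sum_distrib_left)
  also have "\<dots> \<le> t * (x \<bullet> x)" by (rule Bessel[OF x])
  finally have "\<alpha> j * (x \<bullet> x) \<le> (t + e) * (x \<bullet> x)" by (simp add: algebra_simps)
  then show ?thesis using pos by simp
qed

text \<open>Diagonalizing \<open>A\<close> turns both quadratic forms into weighted sums of squares,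
  which differ by at most \<open>opnorm E\<close> times the squared length;
  \<open>Weyl_one_sided\<close> is then applied in both directions.\<close>

lemma factored_eigenvalue_perturbation:
  fixes A Q :: "real mat"
  assumes A: "A \<in> carrier_mat n n" "A\<^sup>T = A" and l: "ordered_eigenvalues A l"
    and Q: "Q \<in> carrier_mat n r" "Q\<^sup>T * Q = 1\<^sub>m r"
    and \<mu>: "\<And>i j. i \<le> j \<Longrightarrow> j < r \<Longrightarrow> \<mu> j \<le> \<mu> i" "\<And>i. i < r \<Longrightarrow> 0 \<le> \<mu> i"
  defines "E \<equiv> A - Q * mat_diag r \<mu> * Q\<^sup>T"
  shows "j < r \<Longrightarrow> j < n \<Longrightarrow> \<bar>l j - \<mu> j\<bar> \<le> opnorm E"
    and "r \<le> j \<Longrightarrow> j < n \<Longrightarrow> \<bar>l j\<bar> \<le> opnorm E"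
proof -
  from l A(1) have cp: "char_poly A = (\<Prod>j<n. [:- l j, 1:])"
    and l_mono: "\<And>i j. i \<le> j \<Longrightarrow> j < n \<Longrightarrow> l j \<le> l i"
    unfolding ordered_eigenvalues_def by auto
  from symmetric_diagonalization[OF A cp] obtain U where
    U: "U \<in> carrier_mat n n" "U\<^sup>T * U = 1\<^sub>m n" and UAU: "U\<^sup>T * A * U = mat_diag n l" .
  \<comment> \<open>A left inverse of a square matrix is a right inverse, so
    \<open>U\<^sup>T\<close> is an isometry too and Bessel's inequality becomes an equality.\<close>
  have UU: "U * U\<^sup>T = 1\<^sub>m n"
    using mat_mult_left_right_inverse[of "U\<^sup>T" n U] U by auto
  have "U * (U\<^sup>T * A * U) * U\<^sup>T = (U * U\<^sup>T) * A * (U * U\<^sup>T)"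
    using U A by (simp add: assoc_mult_mat[of _ n n _ n _ n])
  then have A_eq: "A = U * mat_diag n l * U\<^sup>T" using UAU UU A by simp
  let ?a = "\<lambda>x. \<Sum>i<n. l i * (vec_index (U\<^sup>T *\<^sub>v x) i)\<^sup>2"
  let ?b = "\<lambda>x. \<Sum>i<r. \<mu> i * (vec_index (Q\<^sup>T *\<^sub>v x) i)\<^sup>2"
  have diff: "\<bar>?a x - ?b x\<bar> \<le> opnorm E * (x \<bullet> x)" if x: "x \<in> carrier_vec n" for x
  proof -
    let ?L = "Q * mat_diag r \<mu> * Q\<^sup>T"
    have L: "?L \<in> carrier_mat n n" using Q by auto
    have "x \<bullet> (E *\<^sub>v x) = x \<bullet> (A *\<^sub>v x) - x \<bullet> (?L *\<^sub>v x)"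
      unfolding E_def using A L x
      by (simp add: minus_mult_distrib_mat_vec[OF A(1) L x] scalar_prod_minus_distrib[of _ n])
    also have "x \<bullet> (A *\<^sub>v x) = ?a x"
      using factored_quadratic_form[OF U(1) x, of l] A_eq by simp
    also have "x \<bullet> (?L *\<^sub>v x) = ?b x"
      by (rule factored_quadratic_form[OF Q(1) x])
    finally show ?thesis
      using abs_quadratic_form_le_opnorm[OF minus_carrier_mat[OF L] x, of A] by (simp add: E_def)
  qed
  have Parseval: "(U\<^sup>T *\<^sub>v x) \<bullet> (U\<^sup>T *\<^sub>v x) = x \<bullet> x" if "x \<in> carrier_vec n" for x
    using that U UU by (intro scalar_prod_isometry[of _ n n]) auto
  have Bessel: "t * ((Q\<^sup>T *\<^sub>v x) \<bullet> (Q\<^sup>T *\<^sub>v x)) \<le> t * (x \<bullet> x)"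
    if "x \<in> carrier_vec n" "0 \<le> t" for x t
    using Bessel_inequality[OF Q that(1)] that(2) by (rule mult_left_mono)
  {
    assume j: "j < r" "j < n"
    have "l j \<le> \<mu> j + opnorm E"
    proof (rule Weyl_one_sided[OF U Q(1) j(2)])
      show "?a x \<le> ?b x + opnorm E * (x \<bullet> x)" if "x \<in> carrier_vec n" for x
        using diff[OF that] by linarith
    qed (use j \<mu> l_mono Bessel in auto)
    moreover have "\<mu> j \<le> l j + opnorm E"
    \<comment> \<open>The level is now \<open>l j\<close>, which may be negative; Parseval's
      equality covers this case.\<close>
    proof (rule Weyl_one_sided[OF Q U(1) j(1)])
      show "?b x \<le> ?a x + opnorm E * (x \<bullet> x)" if "x \<in> carrier_vec n" for x
        using diff[OF that] by linarith
    qed (use j \<mu> l_mono Parseval in auto)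
    ultimately show "\<bar>l j - \<mu> j\<bar> \<le> opnorm E" by linarith
  }
  {
    assume j: "r \<le> j" "j < n"
    \<comment> \<open>Level 0: all \<open>r\<close> columns of \<open>Q\<close> come before index
      \<open>j\<close>, so no weight \<mu> is left on the chosen vector.\<close>
    have "l j \<le> 0 + opnorm E"
    proof (rule Weyl_one_sided[OF U Q(1) j(2)])
      show "?a x \<le> ?b x + opnorm E * (x \<bullet> x)" if "x \<in> carrier_vec n" for x
        using diff[OF that] by linarith
    qed (use j l_mono in auto)
    \<comment> \<open>The form compared with \<open>?a\<close> is zero, written in the standard
      basis. It lies below \<open>?b\<close> because the weights \<mu> are nonnegative.\<close>
    moreover have "(\<lambda>_. 0) j \<le> l j + opnorm E"
    proof (rule Weyl_one_sided[OF _ _ U(1) j(2), of "1\<^sub>m n"])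
      show "(\<Sum>i<n. 0 * (vec_index ((1\<^sub>m n)\<^sup>T *\<^sub>v x) i)\<^sup>2) \<le> ?a x + opnorm E * (x \<bullet> x)"
        if "x \<in> carrier_vec n" for x
      proof -
        have "0 \<le> ?b x" by (intro sum_nonneg mult_nonneg_nonneg \<mu>(2)) auto
        then show ?thesis using diff[OF that] by simp
      qed
    qed (use j l_mono Parseval in auto)
    ultimately show "\<bar>l j\<bar> \<le> opnorm E" by simp
  }
qed

text \<open>The factored matrix acts as 0 on the orthogonal complement of the columns of
  \<open>Q\<close>, so \<open>d \<le> \<mu> j\<close> is the gap to that eigenvalue, alongside the
  gaps to the other \<open>\<mu> k\<close>. The sign \<open>s\<close> appears because
  \<open>x\<close> and \<open>- x\<close> satisfy the same hypotheses.\<close>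

lemma factored_eigenvector_perturbation:
  fixes A Q :: "real mat"
  assumes A: "A \<in> carrier_mat n n"
    and Q: "Q \<in> carrier_mat n r" "Q\<^sup>T * Q = 1\<^sub>m r"
    and x: "x \<in> carrier_vec n" "vnorm x = 1" "A *\<^sub>v x = l \<cdot>\<^sub>v x"
    and j: "j < r"
    and l: "\<bar>l - \<mu> j\<bar> \<le> opnorm (A - Q * mat_diag r \<mu> * Q\<^sup>T)"
    and d: "0 < d" "d \<le> \<mu> j" "\<And>k. k < r \<Longrightarrow> k \<noteq> j \<Longrightarrow> d \<le> \<bar>\<mu> k - \<mu> j\<bar>"
  shows "\<exists>s. (s = 1 \<or> s = - 1) \<and>
    vnorm (s \<cdot>\<^sub>v x - col Q j) \<le> 3 * opnorm (A - Q * mat_diag r \<mu> * Q\<^sup>T) / d"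
proof -
  define L where "L = Q * mat_diag r \<mu> * Q\<^sup>T"
  define e where "e = opnorm (A - L)"
  define v where "v = col Q j"
  define a where "a = Q\<^sup>T *\<^sub>v x"
  define c where "c = vec_index a j"
  define z where "z = L *\<^sub>v x - \<mu> j \<cdot>\<^sub>v x"
  have L: "L \<in> carrier_mat n n" using Q by (auto simp: L_def)
  have Lx: "L *\<^sub>v x \<in> carrier_vec n" using L x by auto
  have xx: "x \<bullet> x = 1" using x(2) vnorm_sq[of x] by simp
  have a: "a \<in> carrier_vec r" unfolding a_def using Q x by (auto intro!: mult_mat_vec_carrier)
  have v: "v \<in> carrier_vec n" using Q j by (auto simp: v_def)
  have vx: "v \<bullet> x = c" using Q j by (simp add: v_def c_def a_def)
  have vv: "v \<bullet> v = 1"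
  proof -
    have "(Q\<^sup>T * Q) $$ (j, j) = v \<bullet> v" using Q(1) j by (simp add: v_def)
    then show ?thesis using Q j by simp
  qed
  have sum_a: "(\<Sum>k<r. (vec_index a k)\<^sup>2) \<le> 1"
    using Bessel_inequality[OF Q x(1)] xx scalar_prod_self_sum[OF a] by (simp add: a_def)

  have z_le: "vnorm z \<le> 2 * e"
  proof -
    \<comment> \<open>The eigenvector equation splits \<open>z\<close> into the eigenvalue error and
      the perturbation applied to \<open>x\<close>, each of norm at most \<open>e\<close>.\<close>
    have "z = (l - \<mu> j) \<cdot>\<^sub>v x - (A - L) *\<^sub>v x"
      unfolding z_def minus_mult_distrib_mat_vec[OF A L x(1)] x(3)
      using x Lx carrier_matD[OF L] by (intro eq_vecI) (auto simp: algebra_simps)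
    also have "vnorm \<dots> \<le> vnorm ((l - \<mu> j) \<cdot>\<^sub>v x) + vnorm ((A - L) *\<^sub>v x)"
      using x A L by (intro vnorm_diff_le[of _ n]) (auto intro!: mult_mat_vec_carrier)
    also have "vnorm ((l - \<mu> j) \<cdot>\<^sub>v x) \<le> e"
      using l x by (simp add: vnorm_smult e_def L_def)
    also have "vnorm ((A - L) *\<^sub>v x) \<le> e"
      using vnorm_mult_le_opnorm[of x "A - L"] x A L by (simp add: e_def)
    finally show ?thesis by simp
  qed

  have z_ge: "d\<^sup>2 * (1 - c\<^sup>2) \<le> z \<bullet> z"
  proof -
    have "(L *\<^sub>v x) \<bullet> (L *\<^sub>v x) = (mat_diag r \<mu> *\<^sub>v a) \<bullet> (mat_diag r \<mu> *\<^sub>v a)"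
      unfolding L_def factored_mult_vec[OF Q(1) x(1)] a_def
      by (rule scalar_prod_isometry[OF Q]) auto
    also have "\<dots> = (\<Sum>k<r. (\<mu> k * vec_index a k)\<^sup>2)"
      by (subst scalar_prod_self_sum[of _ r]) (auto simp: mat_diag_mult_vec_index[OF a])
    finally have LxLx: "(L *\<^sub>v x) \<bullet> (L *\<^sub>v x) = (\<Sum>k<r. (\<mu> k * vec_index a k)\<^sup>2)" .
    have xLx: "x \<bullet> (L *\<^sub>v x) = (\<Sum>k<r. \<mu> k * (vec_index a k)\<^sup>2)"
      unfolding L_def a_def by (rule factored_quadratic_form[OF Q(1) x(1)])
    have "z \<bullet> z = (L *\<^sub>v x) \<bullet> (L *\<^sub>v x) - 2 * \<mu> j * (x \<bullet> (L *\<^sub>v x)) + (\<mu> j)\<^sup>2"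
      unfolding z_def using x(1) Lx xx comm_scalar_prod[OF x(1) Lx]
      by (simp add: minus_scalar_prod_distrib[of _ n] scalar_prod_minus_distrib[of _ n]
          power2_eq_square algebra_simps)
    \<comment> \<open>Regrouped, this is the sum of
      \<open>(\<mu> k - \<mu> j)\<^sup>2 * (vec_index a k)\<^sup>2\<close>, plus
      \<open>(\<mu> j)\<^sup>2\<close> times the squared length of the part of \<open>x\<close>
      outside the column space.\<close>
    also have "\<dots> = (\<Sum>k<r. ((\<mu> k - \<mu> j)\<^sup>2 - (\<mu> j)\<^sup>2) * (vec_index a k)\<^sup>2) + (\<mu> j)\<^sup>2"
      unfolding LxLx xLx
      by (simp add: sum_distrib_left power2_eq_square algebra_simps flip: sum_subtractf)
    finally have zz: "z \<bullet> z = (\<Sum>k<r. ((\<mu> k - \<mu> j)\<^sup>2 - (\<mu> j)\<^sup>2) * (vec_index a k)\<^sup>2) + (\<mu> j)\<^sup>2" .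
    \<comment> \<open>At \<open>k = j\<close> the squared gap vanishes, which the correction
      \<open>d\<^sup>2 * c\<^sup>2\<close> absorbs; at every other \<open>k\<close> it is at least
      \<open>d\<^sup>2\<close>.\<close>
    have "(\<Sum>k<r. (d\<^sup>2 - (\<mu> j)\<^sup>2) * (vec_index a k)\<^sup>2 - (if k = j then d\<^sup>2 * c\<^sup>2 else 0))
        \<le> (\<Sum>k<r. ((\<mu> k - \<mu> j)\<^sup>2 - (\<mu> j)\<^sup>2) * (vec_index a k)\<^sup>2)"
    proof (rule sum_mono)
      fix k assume "k \<in> {..<r}"
      then have "d\<^sup>2 \<le> (\<mu> k - \<mu> j)\<^sup>2" if "k \<noteq> j"
        using d(1) d(3)[of k] that by (simp flip: abs_le_square_iff)
      then show "(d\<^sup>2 - (\<mu> j)\<^sup>2) * (vec_index a k)\<^sup>2 - (if k = j then d\<^sup>2 * c\<^sup>2 else 0)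
          \<le> ((\<mu> k - \<mu> j)\<^sup>2 - (\<mu> j)\<^sup>2) * (vec_index a k)\<^sup>2"
        by (cases "k = j") (simp_all add: c_def left_diff_distrib mult_right_mono)
    qed
    also have "(\<Sum>k<r. (d\<^sup>2 - (\<mu> j)\<^sup>2) * (vec_index a k)\<^sup>2 - (if k = j then d\<^sup>2 * c\<^sup>2 else 0))
        = (d\<^sup>2 - (\<mu> j)\<^sup>2) * (\<Sum>k<r. (vec_index a k)\<^sup>2) - d\<^sup>2 * c\<^sup>2"
      using j by (simp add: sum_subtractf sum_distrib_left)
    finally have "(d\<^sup>2 - (\<mu> j)\<^sup>2) * (\<Sum>k<r. (vec_index a k)\<^sup>2) - d\<^sup>2 * c\<^sup>2 + (\<mu> j)\<^sup>2 \<le> z \<bullet> z"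
      by (simp add: zz)
    \<comment> \<open>For the part of \<open>x\<close> outside the column space the factor
      \<open>(\<mu> j)\<^sup>2\<close> is lowered to \<open>d\<^sup>2\<close>.\<close>
    moreover have "0 \<le> ((\<mu> j)\<^sup>2 - d\<^sup>2) * (1 - (\<Sum>k<r. (vec_index a k)\<^sup>2))"
      using d sum_a by (intro mult_nonneg_nonneg) (auto intro: power_mono)
    ultimately show ?thesis by (simp add: algebra_simps)
  qed

  have "\<bar>c\<bar> \<le> 1"
    using Cauchy_Schwarz_vec[OF v x(1)] vx vv x(2) by (simp add: vnorm_def)
  \<comment> \<open>\<open>s\<close> is the sign of \<open>c\<close>, with 1 at 0, so that
    \<open>s \<cdot>\<^sub>v x\<close> has the nonnegative inner product
    \<open>\<bar>c\<bar>\<close> with \<open>v\<close>.\<close>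
  define s :: real where "s = (if 0 \<le> c then 1 else - 1)"
  have s: "s = 1 \<or> s = - 1" and sc: "s * c = \<bar>c\<bar>" and ss: "s * s = 1" by (auto simp: s_def)
  have "(s \<cdot>\<^sub>v x - v) \<bullet> (s \<cdot>\<^sub>v x - v) = s * s * (x \<bullet> x) - 2 * (s * (v \<bullet> x)) + v \<bullet> v"
    using x(1) v comm_scalar_prod[OF x(1) v]
    by (simp add: minus_scalar_prod_distrib[of _ n] scalar_prod_minus_distrib[of _ n] algebra_simps)
  also have "\<dots> = 2 - 2 * \<bar>c\<bar>" using sc ss by (simp add: xx vv vx)
  \<comment> \<open>Since \<open>\<bar>c\<bar> \<le> 1\<close>, squaring can only decrease
    it.\<close>
  also have "\<dots> \<le> 2 * (1 - c\<^sup>2)"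
    using \<open>\<bar>c\<bar> \<le> 1\<close> mult_left_le[of "\<bar>c\<bar>" "\<bar>c\<bar>"] by (simp add: power2_eq_square)
  finally have "(vnorm (s \<cdot>\<^sub>v x - v))\<^sup>2 \<le> 2 * (1 - c\<^sup>2)" by (simp add: vnorm_sq)
  then have "d\<^sup>2 * (vnorm (s \<cdot>\<^sub>v x - v))\<^sup>2 \<le> d\<^sup>2 * (2 * (1 - c\<^sup>2))"
    by (rule mult_left_mono) simp
  also have "\<dots> = 2 * (d\<^sup>2 * (1 - c\<^sup>2))" by simp
  also have "\<dots> \<le> 2 * (vnorm z)\<^sup>2" using z_ge by (simp add: vnorm_sq)
  also have "\<dots> \<le> 2 * (2 * e)\<^sup>2" using z_le by (intro mult_left_mono power_mono) auto
  \<comment> \<open>The constant 3 rounds up \<open>2 * sqrt 2\<close>, as 8 is at most 9.\<close>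
  also have "\<dots> \<le> (3 * e)\<^sup>2" by (simp add: power_mult_distrib)
  finally have "(d * vnorm (s \<cdot>\<^sub>v x - v))\<^sup>2 \<le> (3 * e)\<^sup>2" by (simp add: power_mult_distrib)
  then have "d * vnorm (s \<cdot>\<^sub>v x - v) \<le> 3 * e"
    by (rule power2_le_imp_le) (simp add: e_def)
  then have "vnorm (s \<cdot>\<^sub>v x - v) \<le> 3 * e / d" using d by (simp add: field_simps)
  then show ?thesis using s unfolding v_def e_def L_def by blast
qed

section \<open>The signal part\<close>

lemma double_integral_mat_transpose:
  assumes "\<And>u v i j. i < n \<Longrightarrow> j < n \<Longrightarrow> S u v $$ (i, j) = S u v $$ (j, i)"
  shows "(double_integral_mat U n S)\<^sup>T = double_integral_mat U n S"
  by (rule eq_matI) (simp_all add: double_integral_mat_def assms)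

lemma double_integral_mat_smult:
  assumes "\<And>u v. S u v \<in> carrier_mat n n"
  shows "double_integral_mat U n (\<lambda>u v. c \<cdot>\<^sub>m S u v) = c \<cdot>\<^sub>m double_integral_mat U n S"
proof (rule eq_matI)
  fix i j assume "i < dim_row (c \<cdot>\<^sub>m double_integral_mat U n S)" "j < dim_col (c \<cdot>\<^sub>m double_integral_mat U n S)"
  then have ij: "i < n" "j < n" by (auto simp: double_integral_mat_def)
  have "(c \<cdot>\<^sub>m S u v) $$ (i, j) = c * S u v $$ (i, j)" for u v
    using ij carrier_matD[OF assms, of u v] by simp
  then show "double_integral_mat U n (\<lambda>u v. c \<cdot>\<^sub>m S u v) $$ (i, j)
      = (c \<cdot>\<^sub>m double_integral_mat U n S) $$ (i, j)"
    using ij by (simp add: double_integral_mat_def case_prod_unfold)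
qed (simp_all add: double_integral_mat_def)

lemma smult_smult_mat: "a \<cdot>\<^sub>m (b \<cdot>\<^sub>m A) = (a * b :: real) \<cdot>\<^sub>m A"
  by (rule eq_matI) auto

text \<open>One factor \<open>p\<close> comes from \<open>B\<^sup>T * B\<close> inside the integral,
  the other from writing the two outer copies of \<open>B\<close> as \<open>sqrt p\<close> times
  \<open>Q\<close>.\<close>

lemma signal_part_factored:
  fixes B :: "real mat"
  assumes B: "B \<in> carrier_mat p r" and p: "0 < p"
    and norm: "(1 / real p) \<cdot>\<^sub>m (B\<^sup>T * B) = 1\<^sub>m r"
    and S: "\<And>u v. S u v \<in> carrier_mat r r"
    and diag: "double_integral_mat U r (\<lambda>u v. S u v * (S u v)\<^sup>T) = mat_diag r \<theta>"
  defines "Q \<equiv> (1 / sqrt (real p)) \<cdot>\<^sub>m B"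
  shows "B * double_integral_mat U r (\<lambda>u v. S u v * B\<^sup>T * B * (S u v)\<^sup>T) * B\<^sup>T
      = Q * mat_diag r (\<lambda>j. (real p)\<^sup>2 * \<theta> j) * Q\<^sup>T"
    and "Q\<^sup>T * Q = 1\<^sub>m r"
proof -
  have QT: "Q\<^sup>T = (1 / sqrt (real p)) \<cdot>\<^sub>m B\<^sup>T"
    unfolding Q_def by (rule eq_matI) auto
  have "Q\<^sup>T * Q = (1 / real p) \<cdot>\<^sub>m (B\<^sup>T * B)"
    unfolding QT unfolding Q_def using B p
    by (intro eq_matI) (auto simp: field_simps)
  then show "Q\<^sup>T * Q = 1\<^sub>m r" by (simp add: norm)
  have BB: "B\<^sup>T * B = real p \<cdot>\<^sub>m 1\<^sub>m r"
    unfolding norm[symmetric] using B p by (intro eq_matI) auto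
  have "S u v * B\<^sup>T * B * (S u v)\<^sup>T = real p \<cdot>\<^sub>m (S u v * (S u v)\<^sup>T)" for u v
  proof -
    note [simp] = S[of u v]
    have "S u v * B\<^sup>T * B = S u v * (B\<^sup>T * B)" using B by (intro assoc_mult_mat[of _ r r _ p _ r]) auto
    also have "\<dots> = real p \<cdot>\<^sub>m S u v"
      unfolding BB by (subst mult_smult_distrib[OF S one_carrier_mat]) (simp add: right_mult_one_mat[OF S])
    finally show ?thesis by (simp add: mult_smult_assoc_mat[of _ r r _ r])
  qed
  then have "double_integral_mat U r (\<lambda>u v. S u v * B\<^sup>T * B * (S u v)\<^sup>T) = real p \<cdot>\<^sub>m mat_diag r \<theta>"
    unfolding diag[symmetric] by (simp only:) (use S in \<open>auto intro!: double_integral_mat_smult mult_carrier_mat[of _ r r]\<close>)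
  moreover have "mat_diag r (\<lambda>j. (real p)\<^sup>2 * \<theta> j) = (real p)\<^sup>2 \<cdot>\<^sub>m mat_diag r \<theta>"
    by (rule eq_matI) (auto simp: mat_diag_def)
  moreover have "Q * ((real p)\<^sup>2 \<cdot>\<^sub>m D) * Q\<^sup>T = B * (real p \<cdot>\<^sub>m D) * B\<^sup>T" if "D \<in> carrier_mat r r" for D
  proof -
    have "Q * ((real p)\<^sup>2 \<cdot>\<^sub>m D) * Q\<^sup>T
        = (1 / sqrt (real p) * (1 / sqrt (real p) * (real p)\<^sup>2)) \<cdot>\<^sub>m (B * D * B\<^sup>T)"
      unfolding QT unfolding Q_def using B that
      by (simp add: mult_smult_assoc_mat[of _ p r] mult_smult_distrib[of _ p r] smult_smult_mat)
    also have "1 / sqrt (real p) * (1 / sqrt (real p) * (real p)\<^sup>2) = real p"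
      using p by (simp add: power2_eq_square)
    also have "real p \<cdot>\<^sub>m (B * D * B\<^sup>T) = B * (real p \<cdot>\<^sub>m D) * B\<^sup>T"
      using B that by (simp add: mult_smult_assoc_mat[of _ p r] mult_smult_distrib[of _ p r])
    finally show ?thesis .
  qed
  ultimately show "B * double_integral_mat U r (\<lambda>u v. S u v * B\<^sup>T * B * (S u v)\<^sup>T) * B\<^sup>T
      = Q * mat_diag r (\<lambda>j. (real p)\<^sup>2 * \<theta> j) * Q\<^sup>T"
    by simp
qed

section \<open>From fixed dimension to the asymptotic bounds\<close>

lemma exists_spectral_gap:
  fixes \<theta> :: "nat \<Rightarrow> real"
  assumes "j < r" "0 < \<theta> j" "\<And>k. k < r \<Longrightarrow> k \<noteq> j \<Longrightarrow> \<theta> k \<noteq> \<theta> j"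
  obtains \<delta> where "0 < \<delta>" "\<delta> \<le> \<theta> j" "\<And>k. k < r \<Longrightarrow> k \<noteq> j \<Longrightarrow> \<delta> \<le> \<bar>\<theta> k - \<theta> j\<bar>"
proof
  \<comment> \<open>The minimum is taken over the distances from \<open>\<theta> j\<close> to the
    other \<open>\<theta> k\<close> and to 0; the latter, \<open>\<theta> j\<close> itself, keeps
    the set nonempty when \<open>r = 1\<close>.\<close>
  let ?G = "insert (\<theta> j) ((\<lambda>k. \<bar>\<theta> k - \<theta> j\<bar>) ` ({..<r} - {j}))"
  show "0 < Min ?G" using assms by (subst Min_gr_iff) auto
  show "Min ?G \<le> \<theta> j" by (rule Min_le) auto
  show "Min ?G \<le> \<bar>\<theta> k - \<theta> j\<bar>" if "k < r" "k \<noteq> j" for k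
    by (rule Min_le) (use that in auto)
qed

text \<open>A unit eigenvector of a simple eigenvalue is determined only up to sign, so (ii) is
  stated for a suitable sign \<open>s p\<close> in each dimension. The range
  \<open>r \<le> p\<close> is where \<open>r\<close> orthogonal nonzero columns of length
  \<open>p\<close> can exist.\<close>

theorem proposition1:
  fixes r :: nat
    and a b :: real
    and M :: "nat \<Rightarrow> 'a measure"
    and B :: "nat \<Rightarrow> real mat"
    and f \<epsilon> y :: "nat \<Rightarrow> real \<Rightarrow> 'a \<Rightarrow> real vec"
    and \<theta> :: "nat \<Rightarrow> real"
    and \<theta>_lo \<theta>_hi :: real
    and lam :: "nat \<Rightarrow> nat \<Rightarrow> real"
    and \<xi> :: "nat \<Rightarrow> nat \<Rightarrow> real vec"
  defines "U \<equiv> {a..b}"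
  defines "\<Sigma>\<^sub>f \<equiv> \<lambda>p. cov_mat (M p) r (f p)"
    and "\<Sigma>\<^sub>\<epsilon> \<equiv> \<lambda>p. cov_mat (M p) p (\<epsilon> p)"
    and "\<Sigma>\<^sub>y \<equiv> \<lambda>p. cov_mat (M p) p (y p)"
  defines "\<Omega> \<equiv> \<lambda>p. double_integral_mat U p (\<lambda>u v. \<Sigma>\<^sub>y p u v * (\<Sigma>\<^sub>y p u v)\<^sup>T)"
  defines "\<Omega>\<^sub>L \<equiv> \<lambda>p. B p *
             double_integral_mat U r (\<lambda>u v. \<Sigma>\<^sub>f p u v * (B p)\<^sup>T * B p * (\<Sigma>\<^sub>f p u v)\<^sup>T) * (B p)\<^sup>T"
  defines "\<Omega>\<^sub>R \<equiv> \<lambda>p. \<Omega> p - \<Omega>\<^sub>L p"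
  defines "bt \<equiv> \<lambda>p j. (1 / sqrt (real p)) \<cdot>\<^sub>v col (B p) j"
  assumes r_pos: "0 < r"
    and ab: "a \<le> b"
    and prob: "\<And>p. r \<le> p \<Longrightarrow> prob_space (M p)"
    and B_dim: "\<And>p. r \<le> p \<Longrightarrow> B p \<in> carrier_mat p r"
    and f_proc: "\<And>p. r \<le> p \<Longrightarrow> random_vector_function (M p) U r (f p)"
    and \<epsilon>_proc: "\<And>p. r \<le> p \<Longrightarrow> random_vector_function (M p) U p (\<epsilon> p)"
    and \<Sigma>f_sq: "\<And>p. r \<le> p \<Longrightarrow> square_integrable_entries U r (\<Sigma>\<^sub>f p)"
    and \<Sigma>\<epsilon>_sq: "\<And>p. r \<le> p \<Longrightarrow> square_integrable_entries U p (\<Sigma>\<^sub>\<epsilon> p)"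
    and uncorr: "\<And>p. r \<le> p \<Longrightarrow> uncorrelated (M p) U r p (f p) (\<epsilon> p)"
    and model: "\<And>p u \<omega>. r \<le> p \<Longrightarrow> u \<in> U \<Longrightarrow> \<omega> \<in> space (M p) \<Longrightarrow>
                  y p u \<omega> = B p *\<^sub>v f p u \<omega> + \<epsilon> p u \<omega>"
    and B_norm: "\<And>p. r \<le> p \<Longrightarrow> (1 / real p) \<cdot>\<^sub>m ((B p)\<^sup>T * B p) = 1\<^sub>m r"
    and \<Sigma>f_diag: "\<And>p. r \<le> p \<Longrightarrow>
                  double_integral_mat U r (\<lambda>u v. \<Sigma>\<^sub>f p u v * (\<Sigma>\<^sub>f p u v)\<^sup>T) =
                  mat r r (\<lambda>(i, j). if i = j then \<theta> i else 0)"
    and \<theta>_bounds: "0 < \<theta>_lo" "\<theta>_lo < \<theta>_hi" "\<And>j. j < r \<Longrightarrow> \<theta>_lo < \<theta> j \<and> \<theta> j < \<theta>_hi"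
    and \<theta>_decr: "\<And>i j. i < j \<Longrightarrow> j < r \<Longrightarrow> \<theta> j < \<theta> i"
    and \<Omega>R_small: "(\<lambda>p. opnorm (\<Omega>\<^sub>R p)) \<in> o(\<lambda>p. (real p)\<^sup>2)"
    and ev_ord: "\<And>p. r \<le> p \<Longrightarrow> ordered_eigenvalues (\<Omega> p) (lam p)"
    and evec: "\<And>p j. r \<le> p \<Longrightarrow> j < p \<Longrightarrow> eigenvector (\<Omega> p) (\<xi> p j) (lam p j) \<and> vnorm (\<xi> p j) = 1"
  shows
    "(\<forall>p\<ge>r. (\<forall>j<r. \<bar>lam p j - (real p)\<^sup>2 * \<theta> j\<bar> \<le> opnorm (\<Omega>\<^sub>R p)) \<and>
            (\<forall>j. r \<le> j \<and> j < p \<longrightarrow> \<bar>lam p j\<bar> \<le> opnorm (\<Omega>\<^sub>R p))) \<and>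
     (\<forall>j<r. \<exists>s :: nat \<Rightarrow> real. (\<forall>p. s p = 1 \<or> s p = - 1) \<and>
            (\<lambda>p. vnorm (s p \<cdot>\<^sub>v \<xi> p j - bt p j)) \<in> O(\<lambda>p. opnorm (\<Omega>\<^sub>R p) / (real p)\<^sup>2))"
proof -
  define Q where "Q = (\<lambda>p. (1 / sqrt (real p)) \<cdot>\<^sub>m B p)"
  define \<mu> where "\<mu> = (\<lambda>p j. (real p)\<^sup>2 * \<theta> j)"
  have dim_f: "\<Sigma>\<^sub>f p u v \<in> carrier_mat r r" and dim_y: "\<Sigma>\<^sub>y p u v \<in> carrier_mat p p" for p u v
    by (auto simp: \<Sigma>\<^sub>f_def \<Sigma>\<^sub>y_def cov_mat_def cross_cov_mat_def)
  have \<theta>_pos: "0 < \<theta> j" if "j < r" for j using \<theta>_bounds that by force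
  have \<theta>_mono: "\<theta> j \<le> \<theta> i" if "i \<le> j" "j < r" for i j
    using \<theta>_decr[of i j] that by (cases "i = j") auto
  have \<Omega>_dim: "\<Omega> p \<in> carrier_mat p p" for p by (auto simp: \<Omega>_def double_integral_mat_def)
  have \<Omega>_sym: "(\<Omega> p)\<^sup>T = \<Omega> p" for p
    unfolding \<Omega>_def
  proof (rule double_integral_mat_transpose)
    fix u v i j assume "i < p" "j < p"
    then show "(\<Sigma>\<^sub>y p u v * (\<Sigma>\<^sub>y p u v)\<^sup>T) $$ (i, j) = (\<Sigma>\<^sub>y p u v * (\<Sigma>\<^sub>y p u v)\<^sup>T) $$ (j, i)"
      using carrier_matD[OF dim_y, of p u v] by (auto intro!: comm_scalar_prod[of _ p] carrier_vecI)
  qed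
  have Q_dim: "Q p \<in> carrier_mat p r" and Q_orth: "(Q p)\<^sup>T * Q p = 1\<^sub>m r"
    and \<Omega>R_eq: "\<Omega>\<^sub>R p = \<Omega> p - Q p * mat_diag r (\<mu> p) * (Q p)\<^sup>T" if p: "r \<le> p" for p
  proof -
    have diag: "double_integral_mat U r (\<lambda>u v. \<Sigma>\<^sub>f p u v * (\<Sigma>\<^sub>f p u v)\<^sup>T) = mat_diag r \<theta>"
      unfolding \<Sigma>f_diag[OF p] mat_diag_def by (rule eq_matI) auto
    have "0 < p" using p r_pos by simp
    note * = signal_part_factored[OF B_dim[OF p] this B_norm[OF p] dim_f diag]
    show "Q p \<in> carrier_mat p r" using B_dim[OF p] by (simp add: Q_def)
    show "(Q p)\<^sup>T * Q p = 1\<^sub>m r" using *(2) by (simp add: Q_def)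
    show "\<Omega>\<^sub>R p = \<Omega> p - Q p * mat_diag r (\<mu> p) * (Q p)\<^sup>T"
      using *(1) by (simp add: Q_def \<mu>_def \<Omega>\<^sub>R_def \<Omega>\<^sub>L_def)
  qed
  have \<mu>: "\<And>i j. i \<le> j \<Longrightarrow> j < r \<Longrightarrow> \<mu> p j \<le> \<mu> p i" "\<And>i. i < r \<Longrightarrow> 0 \<le> \<mu> p i" for p
    using \<theta>_pos \<theta>_mono by (simp_all add: \<mu>_def mult_left_mono less_imp_le)
  have lam: "\<bar>lam p j - \<mu> p j\<bar> \<le> opnorm (\<Omega>\<^sub>R p)" if p: "r \<le> p" and j: "j < r" for p j
    unfolding \<Omega>R_eq[OF p]
    by (rule factored_eigenvalue_perturbation(1)[OF \<Omega>_dim \<Omega>_sym ev_ord[OF p] Q_dim[OF p] Q_orth[OF p]])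
      (use \<mu> p j in auto)
  have lam_tail: "\<bar>lam p j\<bar> \<le> opnorm (\<Omega>\<^sub>R p)" if p: "r \<le> p" and j: "r \<le> j" "j < p" for p j
    unfolding \<Omega>R_eq[OF p]
    by (rule factored_eigenvalue_perturbation(2)[OF \<Omega>_dim \<Omega>_sym ev_ord[OF p] Q_dim[OF p] Q_orth[OF p]])
      (use \<mu> j in auto)
  have "\<exists>s :: nat \<Rightarrow> real. (\<forall>p. s p = 1 \<or> s p = - 1) \<and>
      (\<lambda>p. vnorm (s p \<cdot>\<^sub>v \<xi> p j - bt p j)) \<in> O(\<lambda>p. opnorm (\<Omega>\<^sub>R p) / (real p)\<^sup>2)" if j: "j < r" for j
  proof -
    have \<theta>_neq: "\<theta> k \<noteq> \<theta> j" if "k < r" "k \<noteq> j" for k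
      using \<theta>_decr[of j k] \<theta>_decr[of k j] j that by (cases "j < k") auto
    \<comment> \<open>\<open>\<delta>\<close> is fixed before \<open>p\<close> and depends only on
      \<theta>, \<open>r\<close> and \<open>j\<close>, which makes the constant
      \<open>3 / \<delta>\<close> uniform in \<open>p\<close>.\<close>
    from exists_spectral_gap[of j r \<theta>, OF j \<theta>_pos[OF j] \<theta>_neq] obtain \<delta> where
      \<delta>: "0 < \<delta>" "\<delta> \<le> \<theta> j" "\<And>k. k < r \<Longrightarrow> k \<noteq> j \<Longrightarrow> \<delta> \<le> \<bar>\<theta> k - \<theta> j\<bar>"
      by blast
    \<comment> \<open>For \<open>p < r\<close> either sign serves; covering these \<open>p\<close>
      as well lets the signs be chosen as a total function of \<open>p\<close>.\<close>
    have "\<exists>s. (s = 1 \<or> s = - 1) \<and>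
        (r \<le> p \<longrightarrow> vnorm (s \<cdot>\<^sub>v \<xi> p j - bt p j) \<le> 3 / \<delta> * (opnorm (\<Omega>\<^sub>R p) / (real p)\<^sup>2))" for p
    proof (cases "r \<le> p")
      case p: True
      have jp: "j < p" and p0: "0 < real p" using j p by auto
      have "\<xi> p j \<in> carrier_vec p" "vnorm (\<xi> p j) = 1" "\<Omega> p *\<^sub>v \<xi> p j = lam p j \<cdot>\<^sub>v \<xi> p j"
        using evec[OF p jp] carrier_matD[OF \<Omega>_dim, of p] by (auto simp: eigenvector_def)
      note \<xi> = this
      \<comment> \<open>The gaps scale with \<open>(real p)\<^sup>2\<close>, and this is the
        denominator of the rate.\<close>
      have gap: "(real p)\<^sup>2 * \<delta> \<le> \<bar>\<mu> p k - \<mu> p j\<bar>" if "k < r" "k \<noteq> j" for k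
        using mult_left_mono[OF \<delta>(3)[OF that], of "(real p)\<^sup>2"]
        by (simp add: \<mu>_def abs_mult flip: right_diff_distrib)
      have "\<exists>s. (s = 1 \<or> s = - 1) \<and>
          vnorm (s \<cdot>\<^sub>v \<xi> p j - col (Q p) j) \<le> 3 * opnorm (\<Omega>\<^sub>R p) / ((real p)\<^sup>2 * \<delta>)"
        unfolding \<Omega>R_eq[OF p]
        by (rule factored_eigenvector_perturbation[OF \<Omega>_dim Q_dim[OF p] Q_orth[OF p] \<xi> j])
          (use lam[OF p j] \<Omega>R_eq[OF p] p0 \<delta> gap in \<open>auto simp: \<mu>_def intro!: mult_left_mono\<close>)
      moreover have "col (Q p) j = bt p j"
        using B_dim[OF p] j by (intro eq_vecI) (auto simp: Q_def bt_def)
      ultimately show ?thesis using p by (simp add: mult.commute)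
    qed auto
    then obtain s where s: "\<And>p. s p = 1 \<or> s p = - 1"
      "\<And>p. r \<le> p \<Longrightarrow> vnorm (s p \<cdot>\<^sub>v \<xi> p j - bt p j) \<le> 3 / \<delta> * (opnorm (\<Omega>\<^sub>R p) / (real p)\<^sup>2)"
      by metis
    have "(\<lambda>p. vnorm (s p \<cdot>\<^sub>v \<xi> p j - bt p j)) \<in> O(\<lambda>p. opnorm (\<Omega>\<^sub>R p) / (real p)\<^sup>2)"
      using s(2) by (intro bigoI[of _ "3 / \<delta>"] eventually_sequentiallyI[of r]) auto
    then show ?thesis using s(1) by blast
  qed
  then show ?thesis using lam lam_tail by (auto simp: \<mu>_def)
qed

end
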